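(* For every complex $q$ with $|q|<1$, $$\sum_{n,l=0}^\infty\frac{q^{n^2+l^2+n+l}}{(q^2;q)_{n+l}(q;q)_n(q;q)_l}=\frac{1}{(q^2;q)_\infty}\prod_{\substack{m\ge1\\ m\not\equiv0,\pm1\ (\mathrm{mod}\ 7)}}\frac{1}{1-q^m}.$$
   Context: Notation: $(x;q)_n=\prod_{j=0}^{n-1}(1-xq^j)$ for integers $n\ge0$, and $(x;q)_\infty=\prod_{j\ge0}(1-xq^j)$. *)

theory Defs
  imports "HOL-Analysis.Analysis"
begin

definition qpoch :: "complex \<Rightarrow> complex \<Rightarrow> nat \<Rightarrow> complex" where
  "qpoch x q n = (\<Prod>j<n. 1 - x * q ^ j)"

definition qpoch_inf :: "complex \<Rightarrow> complex \<Rightarrow> complex" where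
  "qpoch_inf x q = (\<Prod>j. 1 - x * q ^ j)"

end

theory Submission
  imports Defs
begin

text \<open>
  Write (q)_n for qpoch q q n. Durfee rectangles and Pascal's rule give
  sum_n q^(n^2+n) / ((q)_n (q)_(n+l+1)) = (1/(q)_inf) sum_(j<=l) q^(j^2+j) [l choose j]_q,
  so summing over n first turns the double series into (1 - q)/(q)_inf times the Andrews-Gordon series
  sum_(l>=j) q^(l^2+l+j^2+j) / ((q)_(l-j) (q)_j). Three applications of the Bailey lemma to the unit
  Bailey pair convert that series into a theta series in base q^7. A finite form of the Jacobi triple
  product with parameters a b = q supplies both the unit Bailey pair (a = 1, b = q) and, in the limit
  and in base q^7, the product formula for the theta series (a = q^6, b = q).
\<close>

section \<open>Limits and q-binomial coefficients\<close>

text \<open>Tannery's theorem for summands extended by 0 beyond the cutoff \<open>n\<close>. The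
  passages from finite identities to series rest on this form.\<close>

lemma tendsto_sum_dominated:
  fixes a :: "nat \<Rightarrow> nat \<Rightarrow> 'a :: {real_normed_algebra, banach}"
  assumes lim: "\<And>k. (\<lambda>n. a k n) \<longlonglongrightarrow> b k"
    and bound: "\<And>k n. k \<le> n \<Longrightarrow> norm (a k n) \<le> M k" and M: "summable M"
  shows "(\<lambda>n. \<Sum>k\<le>n. a k n) \<longlonglongrightarrow> suminf b" and "summable (\<lambda>k. norm (b k))"
proof -
  define a' where "a' k n = (if k \<le> n then a k n else 0)" for k n
  have 1: "(\<lambda>n. a' k n) \<longlonglongrightarrow> b k" for k
    by (rule Lim_transform_eventually[OF lim])
      (auto simp: a'_def eventually_at_top_linorder intro!: exI[of _ k])
  \<comment> \<open>The zero entries of \<open>a'\<close> must also be dominated; the bound at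
    \<open>n = k\<close> forces \<open>M k\<close> to be nonnegative.\<close>
  have "M k \<ge> 0" for k
    using bound[of k k] norm_ge_zero order_trans by blast
  then have 2: "eventually (\<lambda>(k,n). norm (a' k n) \<le> M k) (at_top \<times>\<^sub>F at_top)"
    by (intro always_eventually) (auto simp: a'_def bound)
  have 3: "suminf (\<lambda>k. a' k n) = (\<Sum>k\<le>n. a k n)" for n
  proof -
    have "suminf (\<lambda>k. a' k n) = (\<Sum>k\<le>n. a' k n)"
      by (rule suminf_finite) (auto simp: a'_def)
    then show ?thesis by (simp add: a'_def)
  qed
  note T = tannerys_theorem[OF 1 2 M]
  from T show "(\<lambda>n. \<Sum>k\<le>n. a k n) \<longlonglongrightarrow> suminf b" by (simp add: 3)
  from T show "summable (\<lambda>k. norm (b k))" by simp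
qed

text \<open>A pair in a disjoint union lies in one block or meets both, whence the mixed term. This
  does the exponent bookkeeping in the finite triple product.\<close>

lemma choose_two_add: "(m + n) choose 2 = (m choose 2) + (n choose 2) + m * n"
  by (induction m) (simp_all add: numeral_2_eq_2)

lemma prod_lessThan_add:
  fixes f :: "nat \<Rightarrow> 'a :: comm_monoid_mult"
  shows "(\<Prod>i<m + n. f i) = (\<Prod>i<m. f i) * (\<Prod>i<n. f (m + i))"
  by (induction n) (simp_all add: mult.assoc)

section \<open>Finite and infinite q-Pochhammer symbols\<close>

lemma qpoch_0 [simp]: "qpoch x q 0 = 1"
  by (simp add: qpoch_def)

lemma qpoch_Suc: "qpoch x q (Suc n) = qpoch x q n * (1 - x * q ^ n)"
  by (simp add: qpoch_def)

lemma qpoch_Suc_shift: "qpoch x q (Suc n) = (1 - x) * qpoch (x * q) q n"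
  unfolding qpoch_def by (subst prod.lessThan_Suc_shift) (simp add: mult_ac)

lemma one_minus_nonzero:
  fixes z :: complex
  assumes "norm z < 1" shows "1 - z \<noteq> 0"
  using assms by auto

lemma norm_mult_power_less_one:
  fixes x q :: complex
  assumes "norm q < 1" "norm x < 1" shows "norm (x * q ^ n) < 1"
proof -
  have "norm x * norm q ^ n \<le> norm x"
    using assms by (intro mult_right_le_one_le) (auto intro: power_le_one)
  with assms show ?thesis by (simp add: norm_mult norm_power)
qed

lemma qpoch_nonzero:
  assumes "norm q < 1" "norm x < 1" shows "qpoch x q n \<noteq> 0"
  unfolding qpoch_def using one_minus_nonzero[OF norm_mult_power_less_one[OF assms]] by simp

lemma convergent_prod_qpoch:
  fixes x q :: complex
  assumes "norm q < 1" shows "convergent_prod (\<lambda>j. 1 - x * q ^ j)"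
proof -
  have "summable (\<lambda>j. norm x * norm q ^ j)"
    using assms by (intro summable_mult summable_geometric) auto
  moreover have "norm (1 - x * q ^ j - 1) = norm x * norm q ^ j" for j
    by (simp add: norm_mult norm_power)
  ultimately show ?thesis
    by (intro abs_convergent_prod_imp_convergent_prod summable_imp_abs_convergent_prod) (simp only:)
qed

lemma convergent_prod_LIMSEQ_lessThan:
  fixes f :: "nat \<Rightarrow> complex"
  assumes "convergent_prod f"
  shows "(\<lambda>n. \<Prod>i<n. f i) \<longlonglongrightarrow> prodinf f"
proof (rule LIMSEQ_imp_Suc)
  show "(\<lambda>n. \<Prod>i<Suc n. f i) \<longlonglongrightarrow> prodinf f"
    unfolding lessThan_Suc_atMost by (rule convergent_prod_LIMSEQ[OF assms])
qed

lemma qpoch_LIMSEQ: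
  assumes "norm q < 1" shows "qpoch x q \<longlonglongrightarrow> qpoch_inf x q"
  using convergent_prod_LIMSEQ_lessThan[OF convergent_prod_qpoch[OF assms, of x]]
  by (simp add: qpoch_def[abs_def] qpoch_inf_def)

lemma qpoch_inf_nonzero:
  assumes "norm q < 1" "norm x < 1" shows "qpoch_inf x q \<noteq> 0"
  unfolding qpoch_inf_def
  by (intro prodinf_nonzero convergent_prod_qpoch assms
      one_minus_nonzero norm_mult_power_less_one)

lemma qpoch_inf_shift:
  assumes "norm q < 1" "norm x < 1"
  shows "qpoch_inf x q = (1 - x) * qpoch_inf (x * q) q"
proof (rule LIMSEQ_unique)
  show "(\<lambda>n. qpoch x q (Suc n)) \<longlonglongrightarrow> qpoch_inf x q"
    using qpoch_LIMSEQ[OF assms(1)] by (rule LIMSEQ_Suc)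
  show "(\<lambda>n. qpoch x q (Suc n)) \<longlonglongrightarrow> (1 - x) * qpoch_inf (x * q) q"
    unfolding qpoch_Suc_shift by (intro tendsto_intros qpoch_LIMSEQ assms)
qed

section \<open>Gaussian binomial coefficients, Pascal's rules and finite summations\<close>

definition qbinom :: "complex \<Rightarrow> nat \<Rightarrow> nat \<Rightarrow> complex" where
  "qbinom q n k = (if k \<le> n then qpoch q q n / (qpoch q q k * qpoch q q (n - k)) else 0)"

lemma qbinom_eq_0 [simp]: "n < k \<Longrightarrow> qbinom q n k = 0"
  by (simp add: qbinom_def)

context
  fixes q :: complex
  assumes q: "norm q < 1"
begin

abbreviation "Q \<equiv> qpoch q q"
abbreviation "Qinf \<equiv> qpoch_inf q q"

lemma Q_nonzero [simp]: "Q n \<noteq> 0"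
  by (rule qpoch_nonzero[OF q q])

lemma Q_Suc: "Q (Suc n) = Q n * (1 - q ^ Suc n)"
  by (simp add: qpoch_Suc)

lemma qbinom_0_right [simp]: "qbinom q n 0 = 1"
  by (simp add: qbinom_def)

lemma qbinom_self [simp]: "qbinom q n n = 1"
  by (simp add: qbinom_def)

text \<open>With \<open>x = 1 - q ^ Suc k\<close> and \<open>y = 1 - q ^ (n - k)\<close>, over a
  common denominator the two q-Pascal rules read \<open>x + y - x * y = (1 - x) * y + x\<close> and
  \<open>x + y - x * y = y + (1 - y) * x\<close>. The default value 0 of \<open>qbinom\<close> lets
  them hold for every \<open>k\<close>.\<close>

lemma qbinom_Suc_Suc:
  "qbinom q (Suc n) (Suc k) = q ^ Suc k * qbinom q n (Suc k) + qbinom q n k"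
  "qbinom q (Suc n) (Suc k) = qbinom q n (Suc k) + q ^ (n - k) * qbinom q n k"
proof -
  have nz: "1 - q ^ Suc m \<noteq> 0" for m
    using norm_mult_power_less_one[OF q q] one_minus_nonzero by simp
  consider "k < n" | "k = n" | "k > n" by linarith
  then have "qbinom q (Suc n) (Suc k) = q ^ Suc k * qbinom q n (Suc k) + qbinom q n k \<and>
    qbinom q (Suc n) (Suc k) = qbinom q n (Suc k) + q ^ (n - k) * qbinom q n k"
  proof cases
    case 1
    then obtain m where n: "n = Suc (k + m)"
      using less_iff_Suc_add by auto
    define x y where "x = 1 - q ^ Suc k" and "y = 1 - q ^ Suc m"
    have xy: "x \<noteq> 0" "y \<noteq> 0" using nz by (auto simp: x_def y_def)
    have z: "1 - q ^ Suc n = x + y - x * y"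
      by (simp add: n x_def y_def algebra_simps power_add)
    have qx: "q ^ Suc k = 1 - x" "q ^ (n - k) = 1 - y"
      by (simp_all add: n x_def y_def)
    have Q: "Q (Suc k) = Q k * x" "Q (Suc m) = Q m * y" "Q (Suc n) = Q n * (x + y - x * y)"
      unfolding z[symmetric] unfolding x_def y_def by (simp_all only: Q_Suc)
    have e: "Suc n - Suc k = Suc m" "n - Suc k = m" "n - k = Suc m" "Suc k \<le> Suc n" "Suc k \<le> n" "k \<le> n"
      using n by simp_all
    show ?thesis
      unfolding qx unfolding qbinom_def using xy
      by (simp only: e Q if_True) (simp add: field_simps)
  qed (auto simp: Suc_diff_le)
  then show "qbinom q (Suc n) (Suc k) = q ^ Suc k * qbinom q n (Suc k) + qbinom q n k"
    "qbinom q (Suc n) (Suc k) = qbinom q n (Suc k) + q ^ (n - k) * qbinom q n k" by auto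
qed

text \<open>Pascal's rules under a sum with arbitrary weights; these forms drive the inductions in
  \<open>q_binomial_theorem\<close>, \<open>q_vandermonde_limit\<close> and
  \<open>shifted_durfee_sums\<close>.\<close>

lemma sum_qbinom_Suc:
  "(\<Sum>k\<le>Suc n. qbinom q (Suc n) k * f k) =
     (\<Sum>k\<le>n. qbinom q n k * (q ^ k * f k)) + (\<Sum>k\<le>n. qbinom q n k * f (Suc k))"
  "(\<Sum>k\<le>Suc n. qbinom q (Suc n) k * f k) =
     (\<Sum>k\<le>n. qbinom q n k * f k) + (\<Sum>k\<le>n. qbinom q n k * (q ^ (n - k) * f (Suc k)))"
proof -
  \<comment> \<open>The index shift omits the term \<open>k = 0\<close> and adds only
    \<open>k = Suc n\<close>, where the coefficient vanishes.\<close>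
  have s: "(\<Sum>k\<le>n. qbinom q n (Suc k) * g (Suc k)) + g 0 = (\<Sum>k\<le>n. qbinom q n k * g k)" for g
  proof -
    have "(\<Sum>k\<le>Suc n. qbinom q n k * g k) = g 0 + (\<Sum>k\<le>n. qbinom q n (Suc k) * g (Suc k))"
      by (subst sum.atMost_Suc_shift) simp
    then show ?thesis by (simp add: add.commute)
  qed
  show "(\<Sum>k\<le>Suc n. qbinom q (Suc n) k * f k) =
     (\<Sum>k\<le>n. qbinom q n k * (q ^ k * f k)) + (\<Sum>k\<le>n. qbinom q n k * f (Suc k))"
    using s[of "\<lambda>k. q ^ k * f k"]
    by (subst sum.atMost_Suc_shift) (simp add: qbinom_Suc_Suc(1) algebra_simps sum.distrib)
  show "(\<Sum>k\<le>Suc n. qbinom q (Suc n) k * f k) =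
     (\<Sum>k\<le>n. qbinom q n k * f k) + (\<Sum>k\<le>n. qbinom q n k * (q ^ (n - k) * f (Suc k)))"
    using s[of f]
    by (subst sum.atMost_Suc_shift) (simp add: qbinom_Suc_Suc(2) algebra_simps sum.distrib)
qed

text \<open>Splitting the last factor \<open>y - x * q ^ n\<close> produces the two sums of the
  second Pascal rule. The homogeneous form allows \<open>y\<close> to be a power of \<open>q\<close>
  without any division.\<close>

lemma q_binomial_theorem:
  "(\<Prod>i<n. y - x * q ^ i) =
     (\<Sum>k\<le>n. qbinom q n k * ((-1) ^ k * q ^ (k choose 2) * x ^ k * y ^ (n - k)))"
proof (induction n)
  case (Suc n)
  have "(\<Prod>i<Suc n. y - x * q ^ i) = (\<Prod>i<n. y - x * q ^ i) * y + - ((\<Prod>i<n. y - x * q ^ i) * (x * q ^ n))"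
    by (simp add: algebra_simps)
  also have "(\<Prod>i<n. y - x * q ^ i) * y =
      (\<Sum>k\<le>n. qbinom q n k * ((-1) ^ k * q ^ (k choose 2) * x ^ k * y ^ (Suc n - k)))"
    unfolding Suc.IH sum_distrib_right by (intro sum.cong) (auto simp: Suc_diff_le)
  also have "- ((\<Prod>i<n. y - x * q ^ i) * (x * q ^ n)) =
      (\<Sum>k\<le>n. qbinom q n k * (q ^ (n - k) *
        ((-1) ^ Suc k * q ^ (Suc k choose 2) * x ^ Suc k * y ^ (Suc n - Suc k))))"
    unfolding Suc.IH sum_distrib_right sum_negf[symmetric]
  proof (intro sum.cong refl, goal_cases)
    case (1 k)
    then have "q ^ (n - k) * q ^ (Suc k choose 2) = q ^ (k choose 2) * q ^ n"
      by (simp add: power_add[symmetric] numeral_2_eq_2 add.commute)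
    then show ?case by simp
  qed
  finally show ?case
    by (simp add: sum_qbinom_Suc(2) del: sum.atMost_Suc)
qed (simp add: binomial_eq_0)

text \<open>If B(N, c) denotes the left-hand side, Pascal's rule yields B(N + 1, c) = B(N, c + 1).\<close>
lemma q_vandermonde_limit:
  "(\<Sum>m\<le>N. qbinom q N m * (q ^ (m * (m + c)) / Q (m + c))) = 1 / Q (N + c)"
proof (induction N arbitrary: c)
  case (Suc N)
  \<comment> \<open>\<open>?d m\<close> is the summand of index \<open>Suc m\<close>. Raising the
    denominator from \<open>Q (m + c)\<close> to \<open>Q (m + Suc c)\<close> subtracts it, and the
    shifted half of Pascal's rule adds it back.\<close>
  let ?d = "\<lambda>m. q ^ (m\<^sup>2 + m * (c + 2) + c + 1) / Q (m + Suc c)"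
  have "(\<Sum>m\<le>N. qbinom q N m * (q ^ m * (q ^ (m * (m + c)) / Q (m + c)))) =
      (\<Sum>m\<le>N. qbinom q N m * (q ^ (m * (m + Suc c)) / Q (m + Suc c) - ?d m))"
  proof (intro sum.cong refl arg_cong2[of _ _ _ _ "(*)"], goal_cases)
    case (1 m)
    have "1 - q ^ Suc (m + c) \<noteq> 0"
      using Q_nonzero[of "Suc (m + c)"] by (simp only: Q_Suc) auto
    then have "q ^ m * (q ^ (m * (m + c)) / Q (m + c)) =
        q ^ m * q ^ (m * (m + c)) * (1 - q ^ Suc (m + c)) / Q (m + Suc c)"
      by (simp only: add_Suc_right Q_Suc) simp
    also have "\<dots> = q ^ (m * (m + Suc c)) / Q (m + Suc c) - ?d m"
      by (simp add: diff_divide_distrib[symmetric] algebra_simps power_add power2_eq_square)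
    finally show ?case .
  qed
  moreover have "(\<Sum>m\<le>N. qbinom q N m * (q ^ (Suc m * (Suc m + c)) / Q (Suc m + c))) =
      (\<Sum>m\<le>N. qbinom q N m * ?d m)"
    by (simp add: algebra_simps power2_eq_square power_add)
  ultimately have "(\<Sum>m\<le>Suc N. qbinom q (Suc N) m * (q ^ (m * (m + c)) / Q (m + c))) =
      (\<Sum>m\<le>N. qbinom q N m * (q ^ (m * (m + Suc c)) / Q (m + Suc c)))"
    by (subst sum_qbinom_Suc(1)) (simp only: sum.distrib[symmetric] distrib_left[symmetric] diff_add_cancel)
  also have "\<dots> = 1 / Q (Suc N + c)"
    unfolding Suc.IH by simp
  finally show ?case .
qed simp

section \<open>Limits, uniform bounds and Durfee rectangles\<close>

lemma Q_inf_nonzero [simp]: "Qinf \<noteq> 0"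
  by (rule qpoch_inf_nonzero[OF q q])

lemma tendsto_Q:
  assumes "filterlim f at_top F" shows "((\<lambda>n. Q (f n)) \<longlongrightarrow> Qinf) F"
  using qpoch_LIMSEQ[OF q] assms by (rule filterlim_compose)

text \<open>\<open>Q\<close> and \<open>1 / Q\<close> both converge because the limit
  \<open>Qinf\<close> is nonzero. The common constant serves in all domination arguments
  below.\<close>

lemma Q_bounds:
  obtains C where "\<And>n. norm (Q n) \<le> C" "\<And>n. norm (1 / Q n) \<le> C" "C \<ge> 0"
proof -
  have "Bseq Q"
    using qpoch_LIMSEQ[OF q] by (intro convergent_imp_Bseq convergentI)
  then obtain A where A: "\<And>n. norm (Q n) \<le> A"
    unfolding Bseq_def by blast
  have "(\<lambda>n. 1 / Q n) \<longlonglongrightarrow> 1 / Qinf"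
    by (intro tendsto_intros qpoch_LIMSEQ q) simp
  then have "Bseq (\<lambda>n. 1 / Q n)"
    by (intro convergent_imp_Bseq convergentI)
  then obtain B where B: "\<And>n. norm (1 / Q n) \<le> B"
    unfolding Bseq_def by blast
  show ?thesis
    using A B order_trans[OF norm_ge_zero A[of 0]]
    by (intro that[of "max A B"]) (auto simp: le_max_iff_disj)
qed

lemma norm_power_le: "m \<le> n \<Longrightarrow> norm (q ^ n) \<le> norm q ^ m"
  unfolding norm_power using q by (intro power_decreasing) auto

lemma summable_norm_q: "summable (\<lambda>n. c * norm q ^ n)"
  using q by (intro summable_mult summable_geometric) auto

lemma LIMSEQ_qbinom: "(\<lambda>N. qbinom q N m) \<longlonglongrightarrow> 1 / Q m"
proof (rule Lim_transform_eventually)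
  have "(\<lambda>N. Q N / (Q m * Q (N - m))) \<longlonglongrightarrow> Qinf / (Q m * Qinf)"
    by (intro tendsto_intros tendsto_Q filterlim_ident filterlim_minus_const_nat_at_top) auto
  then show "(\<lambda>N. Q N / (Q m * Q (N - m))) \<longlonglongrightarrow> 1 / Q m"
    by simp
  show "\<forall>\<^sub>F N in sequentially. Q N / (Q m * Q (N - m)) = qbinom q N m"
    using eventually_ge_at_top[of m] by eventually_elim (simp add: qbinom_def)
qed

text \<open>The limit of \<open>q_vandermonde_limit\<close> as \<open>N\<close> tends to infinity.
  Combinatorially, each partition is cut along its largest rectangle with sides \<open>m\<close> and
  \<open>m + c\<close>.\<close>

lemma durfee_rectangle_sums: "(\<lambda>m. q ^ (m * (m + c)) / (Q m * Q (m + c))) sums (1 / Qinf)"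
proof -
  obtain C where C: "\<And>n. norm (Q n) \<le> C" "\<And>n. norm (1 / Q n) \<le> C" "C \<ge> 0"
    using Q_bounds by blast
  let ?a = "\<lambda>m N. qbinom q N m * (q ^ (m * (m + c)) / Q (m + c))"
  let ?b = "\<lambda>m. 1 / Q m * (q ^ (m * (m + c)) / Q (m + c))"
  have lim: "(\<lambda>N. ?a m N) \<longlonglongrightarrow> ?b m" for m
    by (intro tendsto_intros LIMSEQ_qbinom)
  have bound: "norm (?a m N) \<le> (C * C * C * C) * norm q ^ m" if "m \<le> N" for m N
  proof -
    have "?a m N = Q N * (1 / Q m) * (1 / Q (N - m)) * (1 / Q (m + c)) * q ^ (m * (m + c))"
      using that by (simp add: qbinom_def)
    also have "norm \<dots> \<le> C * C * C * C * norm q ^ m"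
      unfolding norm_mult[of _ "_ :: complex"] using C
      by (intro mult_mono norm_power_le mult_nonneg_nonneg norm_ge_zero) auto
    finally show ?thesis .
  qed
  note T = tendsto_sum_dominated[of ?a ?b, OF lim bound summable_norm_q]
  have "(\<lambda>N. 1 / Q (N + c)) \<longlonglongrightarrow> 1 / Qinf"
    by (intro tendsto_intros tendsto_Q filterlim_add_const_nat_at_top) auto
  with T(1) have "suminf ?b = 1 / Qinf"
    unfolding q_vandermonde_limit by (rule LIMSEQ_unique)
  moreover have "summable ?b"
    using T(2) by (rule summable_norm_cancel)
  ultimately show ?thesis
    using summable_sums[of ?b] by simp
qed

text \<open>Both sides satisfy U(l + 1, c) = U(l, c) + q^(c+l+1) U(l, c + 1).\<close>
lemma shifted_durfee_sums:
  "(\<lambda>n. q ^ (n * (n + c)) / (Q n * Q (n + c + l))) sums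
     ((\<Sum>j\<le>l. qbinom q l j * q ^ (j * (j + c))) / Qinf)"
proof (induction l arbitrary: c)
  case 0
  show ?case using durfee_rectangle_sums by simp
next
  case (Suc l)
  let ?S = "\<lambda>l c. \<Sum>j\<le>l. qbinom q l j * q ^ (j * (j + c))"
  \<comment> \<open>The recursion holds termwise: over the denominator
    \<open>Q (Suc (n + c + l))\<close> the two terms carry the weights
    \<open>1 - q ^ Suc (n + c + l)\<close> and \<open>q ^ Suc (n + c + l)\<close>, which add up to
    1.\<close>
  have "q ^ (n * (n + c)) / (Q n * Q (n + c + l)) +
      q ^ Suc (c + l) * (q ^ (n * (n + Suc c)) / (Q n * Q (n + Suc c + l))) =
      q ^ (n * (n + c)) / (Q n * Q (n + c + Suc l))" for n
  proof -
    have "Q (Suc (n + c + l)) \<noteq> 0" by simp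
    then have "1 - q ^ Suc (n + c + l) \<noteq> 0" by (simp only: Q_Suc) auto
    moreover have "q ^ Suc (c + l) * q ^ (n * (n + Suc c)) = q ^ (n * (n + c)) * q ^ Suc (n + c + l)"
      by (simp add: power_add[symmetric] algebra_simps)
    then have "q ^ Suc (c + l) * (q ^ (n * (n + Suc c)) / (Q n * Q (n + Suc c + l))) =
        q ^ (n * (n + c)) * q ^ Suc (n + c + l) / (Q n * Q (Suc (n + c + l)))"
      by (simp add: mult.assoc[symmetric])
    ultimately show ?thesis
      by (simp add: Q_Suc divide_simps del: power_Suc) (simp add: algebra_simps)
  qed
  moreover have "?S l c / Qinf + q ^ Suc (c + l) * (?S l (Suc c) / Qinf) = ?S (Suc l) c / Qinf"
  proof -
    \<comment> \<open>The right-hand side is the shifted sum in the second Pascal rule.\<close>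
    have "q ^ Suc (c + l) * ?S l (Suc c) =
        (\<Sum>j\<le>l. qbinom q l j * (q ^ (l - j) * q ^ (Suc j * (Suc j + c))))"
      unfolding sum_distrib_left
    proof (intro sum.cong refl, goal_cases)
      case (1 j)
      then have "Suc (c + l) + j * (j + Suc c) = l - j + Suc j * (Suc j + c)"
        by simp
      then have "q ^ Suc (c + l) * q ^ (j * (j + Suc c)) = q ^ (l - j) * q ^ (Suc j * (Suc j + c))"
        by (simp only: power_add[symmetric])
      then show ?case by (simp only: mult.left_commute)
    qed
    then show ?thesis
      unfolding sum_qbinom_Suc(2) by (simp add: add_divide_distrib)
  qed
  ultimately show ?case
    using sums_add[OF Suc.IH[of c] sums_mult[OF Suc.IH[of "Suc c"], of "q ^ Suc (c + l)"]]
    by simp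
qed

section \<open>Bailey pairs and the Jacobi triple product\<close>

text \<open>
  Bailey pairs relative to a = q; the usual denominator (q^2;q)_(n+j) is replaced by
  (q)_(n+j+1) = (1 - q) (q^2;q)_(n+j).
\<close>
definition bailey :: "(nat \<Rightarrow> complex) \<Rightarrow> nat \<Rightarrow> complex" where
  "bailey \<alpha> n = (\<Sum>j\<le>n. \<alpha> j / (Q (n - j) * Q (n + j + 1)))"

text \<open>Bailey's lemma with both free parameters sent to infinity. Put \<open>r = j + m\<close>;
  since \<open>r * (r + 1) = j * (j + 1) + m * (m + 2 * j + 1)\<close>, the inner sum over
  \<open>m\<close> is \<open>q_vandermonde_limit\<close> with \<open>N = n - j\<close> and
  \<open>c = 2 * j + 1\<close>.\<close>

lemma bailey_step:
  "(\<Sum>r\<le>n. q ^ (r * (r + 1)) / Q (n - r) * bailey \<alpha> r) = bailey (\<lambda>j. q ^ (j * (j + 1)) * \<alpha> j) n"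
proof -
  let ?g = "\<lambda>r j. q ^ (r * (r + 1)) / Q (n - r) * (\<alpha> j / (Q (r - j) * Q (r + j + 1)))"
  have "(\<Sum>r\<le>n. q ^ (r * (r + 1)) / Q (n - r) * bailey \<alpha> r) = (\<Sum>r\<le>n. \<Sum>j\<le>r. ?g r j)"
    by (simp add: bailey_def sum_distrib_left)
  also have "\<dots> = (\<Sum>(r, j)\<in>Sigma {..n} (\<lambda>r. {..r}). ?g r j)"
    by (subst sum.Sigma) auto
  also have "\<dots> = (\<Sum>(j, m)\<in>Sigma {..n} (\<lambda>j. {..n - j}). ?g (j + m) j)"
    by (rule sum.reindex_bij_witness[of _ "\<lambda>(j, m). (j + m, j)" "\<lambda>(r, j). (j, r - j)"]) auto
  also have "\<dots> = (\<Sum>j\<le>n. \<Sum>m\<le>n - j. ?g (j + m) j)"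
    by (subst sum.Sigma) auto
  also have "\<dots> = bailey (\<lambda>j. q ^ (j * (j + 1)) * \<alpha> j) n"
    unfolding bailey_def
  proof (intro sum.cong refl, goal_cases)
    case (1 j)
    let ?N = "n - j" and ?c = "2 * j + 1"
    have "?g (j + m) j = q ^ (j * (j + 1)) * \<alpha> j / Q ?N *
        (qbinom q ?N m * (q ^ (m * (m + ?c)) / Q (m + ?c)))" if "m \<le> ?N" for m
    proof -
      have "(j + m) * (j + m + 1) = j * (j + 1) + m * (m + ?c)"
        by (simp add: algebra_simps)
      moreover have "n - (j + m) = ?N - m" "j + m - j = m" "j + m + j + 1 = m + ?c"
        by simp_all
      ultimately have "?g (j + m) j =
          q ^ (j * (j + 1) + m * (m + ?c)) / Q (?N - m) * (\<alpha> j / (Q m * Q (m + ?c)))"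
        by (simp only:)
      also have "\<dots> = q ^ (j * (j + 1)) * \<alpha> j / Q ?N *
          (qbinom q ?N m * (q ^ (m * (m + ?c)) / Q (m + ?c)))"
        using that by (simp add: qbinom_def power_add mult_ac)
      finally show ?thesis .
    qed
    then have "(\<Sum>m\<le>?N. ?g (j + m) j) = q ^ (j * (j + 1)) * \<alpha> j / Q ?N * (1 / Q (?N + ?c))"
      unfolding q_vandermonde_limit[symmetric] sum_distrib_left by (intro sum.cong) auto
    also have "?N + ?c = n + j + 1"
      using 1 by simp
    finally show ?case by simp
  qed
  finally show ?thesis .
qed

text \<open>For fixed \<open>j\<close> both denominators tend to \<open>Qinf\<close>, and
  \<open>M\<close> dominates up to a constant. Boundedness is recorded separately because it later
  controls \<open>gordon_poly\<close>.\<close>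

lemma LIMSEQ_bailey:
  assumes \<alpha>: "\<And>j. norm (\<alpha> j) \<le> M j" and M: "summable M"
  shows "bailey \<alpha> \<longlonglongrightarrow> suminf \<alpha> / (Qinf * Qinf)"
    and "Bseq (bailey \<alpha>)"
proof -
  obtain C where C: "\<And>n. norm (Q n) \<le> C" "\<And>n. norm (1 / Q n) \<le> C" "C \<ge> 0"
    using Q_bounds by blast
  let ?a = "\<lambda>j n. \<alpha> j / (Q (n - j) * Q (n + j + 1))"
  let ?b = "\<lambda>j. \<alpha> j / (Qinf * Qinf)"
  have lim: "(\<lambda>n. ?a j n) \<longlonglongrightarrow> ?b j" for j
    by (intro tendsto_intros tendsto_Q filterlim_minus_const_nat_at_top
        filterlim_add_const_nat_at_top[of "j + 1", unfolded add.assoc[symmetric]]) auto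
  have bound: "norm (?a j n) \<le> M j * (C * C)" for j n
  proof -
    have "?a j n = \<alpha> j * ((1 / Q (n - j)) * (1 / Q (n + j + 1)))" by simp
    also have "norm \<dots> \<le> M j * (C * C)"
      unfolding norm_mult[of _ "_ :: complex"] using C \<alpha> order_trans[OF norm_ge_zero \<alpha>]
      by (intro mult_mono mult_nonneg_nonneg norm_ge_zero) auto
    finally show ?thesis .
  qed
  have "summable \<alpha>"
    by (rule summable_comparison_test'[OF M \<alpha>])
  then have "suminf ?b = suminf \<alpha> / (Qinf * Qinf)"
    by (rule suminf_divide)
  then show "bailey \<alpha> \<longlonglongrightarrow> suminf \<alpha> / (Qinf * Qinf)"
    using tendsto_sum_dominated(1)[of ?a ?b, OF lim bound summable_mult2[OF M]]
    unfolding bailey_def by simp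
  then show "Bseq (bailey \<alpha>)"
    by (intro convergent_imp_Bseq convergentI)
qed

text \<open>
  The q-binomial theorem for prod_(i<2n+1) (q^(n+1) - a q^i): the terms of index n + 1 + j and n - j
  become the two halves of the j-th summand. Two parameters with a b = q avoid dividing by a.
\<close>
lemma finite_jacobi_triple_product:
  assumes ab: "a * b = q" and "q \<noteq> 0"
  shows "Q (2 * n + 1) *
      bailey (\<lambda>j. (-1) ^ j * (a ^ j * q ^ (j choose 2) - b ^ Suc j * q ^ (Suc j choose 2))) n =
      qpoch a q n * qpoch b q (Suc n)"
proof -
  have [simp]: "a \<noteq> 0" using assms by auto
  \<comment> \<open>\<open>K\<close> collects the monomials \<open>- a * q ^ i\<close> from the
    first \<open>n + 1\<close> factors of the product and \<open>q ^ Suc n\<close> from each of the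
    last \<open>n\<close>.\<close>
  define K where "K = (- a) ^ Suc n * q ^ ((Suc n choose 2) + n * (n + 1))"
  have K: "K \<noteq> 0" using assms by (auto simp: K_def)
  let ?N = "2 * n + 1"
  let ?t = "\<lambda>k. qbinom q ?N k * ((-1) ^ k * q ^ (k choose 2) * a ^ k * (q ^ Suc n) ^ (?N - k))"
  have N: "?N = Suc n + n" by simp
  have "(\<Prod>i<?N. q ^ Suc n - a * q ^ i) =
      (\<Prod>i<Suc n. q ^ Suc n - a * q ^ i) * (\<Prod>m<n. q ^ Suc n - a * q ^ (Suc n + m))"
    unfolding N prod_lessThan_add by (rule refl)
  \<comment> \<open>Here \<open>a * b = q\<close> enters: \<open>q ^ Suc n\<close> is
    \<open>a * b * q ^ i * q ^ (n - i)\<close>, so \<open>b\<close> appears with the exponents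
    reversed.\<close>
  also have "(\<Prod>i<Suc n. q ^ Suc n - a * q ^ i) = (\<Prod>i<Suc n. (- a) * q ^ i * (1 - b * q ^ (n - i)))"
  proof (intro prod.cong refl, goal_cases)
    case (1 i)
    then have "q ^ Suc n = (a * b) * (q ^ i * q ^ (n - i))"
      unfolding ab by (simp add: power_add[symmetric])
    then show ?case by (simp add: algebra_simps)
  qed
  also have "\<dots> = (- a) ^ Suc n * q ^ (Suc n choose 2) * qpoch b q (Suc n)"
  proof -
    have "(\<Prod>i<m. q ^ i) = q ^ (m choose 2)" for m
      by (induction m) (simp_all add: numeral_2_eq_2 power_add binomial_eq_0)
    moreover have "(\<Prod>i<Suc n. 1 - b * q ^ (n - i)) = qpoch b q (Suc n)"
      unfolding qpoch_def
      by (rule prod.reindex_bij_witness[of _ "\<lambda>i. n - i" "\<lambda>i. n - i"]) auto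
    ultimately show ?thesis
      by (simp only: prod.distrib prod_constant card_lessThan)
  qed
  also have "(\<Prod>m<n. q ^ Suc n - a * q ^ (Suc n + m)) = q ^ (n * (n + 1)) * qpoch a q n"
  proof -
    have "(\<Prod>m<n. q ^ Suc n - a * q ^ (Suc n + m)) = (\<Prod>m<n. q ^ Suc n * (1 - a * q ^ m))"
      by (intro prod.cong refl) (simp add: algebra_simps power_add)
    also have "\<dots> = (q ^ Suc n) ^ n * qpoch a q n"
      by (simp only: prod.distrib prod_constant card_lessThan qpoch_def)
    also have "(q ^ Suc n) ^ n = q ^ (n * (n + 1))"
      by (simp only: power_mult[symmetric] Suc_eq_plus1 mult.commute)
    finally show ?thesis .
  qed
  finally have L: "(\<Prod>i<?N. q ^ Suc n - a * q ^ i) = K * (qpoch a q n * qpoch b q (Suc n))"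
    by (simp add: K_def power_add)
  have "(\<Sum>k\<le>?N. ?t k) = (\<Sum>k\<in>{..n} \<union> {Suc n..?N}. ?t k)"
    by (intro sum.cong) auto
  also have "\<dots> = (\<Sum>k\<le>n. ?t k) + (\<Sum>k=Suc n..?N. ?t k)"
    by (intro sum.union_disjoint) auto
  also have "(\<Sum>k\<le>n. ?t k) = (\<Sum>j\<le>n. ?t (n - j))"
    by (rule sum.reindex_bij_witness[of _ "\<lambda>i. n - i" "\<lambda>i. n - i"]) auto
  also have "(\<Sum>k=Suc n..?N. ?t k) = (\<Sum>j\<le>n. ?t (Suc n + j))"
    by (rule sum.reindex_bij_witness[of _ "\<lambda>j. Suc n + j" "\<lambda>k. k - Suc n"]) auto
  also have "(\<Sum>j\<le>n. ?t (n - j)) + (\<Sum>j\<le>n. ?t (Suc n + j)) = K * (Q ?N *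
      bailey (\<lambda>j. (-1) ^ j * (a ^ j * q ^ (j choose 2) - b ^ Suc j * q ^ (Suc j choose 2))) n)"
    unfolding sum.distrib[symmetric] bailey_def sum_distrib_left
  proof (intro sum.cong refl, goal_cases)
    case (1 j)
    then obtain r where n: "n = r + j"
      by (metis atMost_iff le_iff_add add.commute)
    \<comment> \<open>The indices \<open>n - j\<close> and \<open>Suc n + j\<close> add up to
      \<open>?N\<close>, so both have the same q-binomial coefficient.\<close>
    define B where "B = Q ?N / (Q (n - j) * Q (n + j + 1))"
    have B: "qbinom q ?N (n - j) = B" "qbinom q ?N (Suc n + j) = B"
    proof -
      have "?N - (n - j) = n + j + 1" "?N - (Suc n + j) = n - j" "Suc n + j = n + j + 1"
        "n - j \<le> ?N" "n + j + 1 \<le> ?N"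
        by (simp_all add: n)
      then show "qbinom q ?N (n - j) = B" "qbinom q ?N (Suc n + j) = B"
        by (simp_all only: qbinom_def B_def if_True mult.commute)
    qed
    have upper: "(-1) ^ (Suc n + j) * q ^ (Suc n + j choose 2) * a ^ (Suc n + j) * (q ^ Suc n) ^ (?N - (Suc n + j)) =
        K * ((-1) ^ j * (a ^ j * q ^ (j choose 2)))"
    proof -
      have "(Suc n + j choose 2) + Suc n * r = (Suc n choose 2) + n * (n + 1) + (j choose 2)"
        unfolding choose_two_add by (simp add: n algebra_simps)
      then have "q ^ (Suc n + j choose 2) * (q ^ Suc n) ^ r = q ^ ((Suc n choose 2) + n * (n + 1)) * q ^ (j choose 2)"
        by (simp only: power_add[symmetric] power_mult[symmetric])
      moreover have "?N - (Suc n + j) = r" by (simp add: n)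
      ultimately show ?thesis
        by (simp only: K_def power_add power_minus[of a] ac_simps)
    qed
    have lower: "(-1) ^ (n - j) * q ^ (n - j choose 2) * a ^ (n - j) * (q ^ Suc n) ^ (?N - (n - j)) =
        - K * ((-1) ^ j * (b ^ Suc j * q ^ (Suc j choose 2)))"
    proof -
      have c: "j * (j + 1) = 2 * (Suc j choose 2)"
        by (induction j) (simp_all add: numeral_2_eq_2 binomial_eq_0)
      have "(Suc n choose 2) = (r choose 2) + (Suc j choose 2) + r * Suc j"
        using choose_two_add[of r "Suc j"] by (simp add: n)
      with c have e: "(r choose 2) + Suc n * (Suc n + j) =
          Suc j + (Suc n choose 2) + n * (n + 1) + (Suc j choose 2)"
        by (simp add: n algebra_simps)
      \<comment> \<open>Of the \<open>n + 1\<close> factors \<open>a\<close> in \<open>K\<close>,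
        \<open>j + 1\<close> combine with \<open>b ^ Suc j\<close> into a power of \<open>q\<close>,
        leaving \<open>a ^ r\<close>.\<close>
      have "K * (b ^ Suc j * q ^ (Suc j choose 2)) =
          (-1) ^ Suc n * (a ^ r * (a * b) ^ Suc j) * q ^ ((Suc n choose 2) + n * (n + 1)) * q ^ (Suc j choose 2)"
        by (simp add: K_def n power_minus[of a] power_add power_mult_distrib)
      also have "\<dots> = (-1) ^ Suc n * a ^ r * (q ^ (r choose 2) * (q ^ Suc n) ^ (Suc n + j))"
        unfolding ab power_mult[symmetric] power_add[symmetric] e by (simp add: power_add)
      finally have *: "K * (b ^ Suc j * q ^ (Suc j choose 2)) =
          (-1) ^ Suc n * a ^ r * (q ^ (r choose 2) * (q ^ Suc n) ^ (Suc n + j))" .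
      have "- K * ((-1) ^ j * (b ^ Suc j * q ^ (Suc j choose 2))) =
          (-1) ^ j * (-1) ^ n * a ^ r * (q ^ (r choose 2) * (q ^ Suc n) ^ (Suc n + j))"
      proof -
        have "- K * ((-1) ^ j * (b ^ Suc j * q ^ (Suc j choose 2))) =
            (-1) ^ j * - (K * (b ^ Suc j * q ^ (Suc j choose 2)))"
          by (simp only: mult_minus_left mult_minus_right mult.left_commute)
        then show ?thesis unfolding * by simp
      qed
      moreover have "(-1) ^ j * (-1) ^ n = ((-1) ^ r :: complex)"
        by (simp add: n power_add)
      moreover have "?N - (n - j) = Suc n + j" "n - j = r" by (simp_all add: n)
      ultimately show ?thesis by (simp only: ac_simps)
    qed
    show ?case
      unfolding B upper lower by (simp add: B_def algebra_simps diff_divide_distrib)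
  qed
  finally have R: "(\<Sum>k\<le>?N. ?t k) = K * (Q ?N *
      bailey (\<lambda>j. (-1) ^ j * (a ^ j * q ^ (j choose 2) - b ^ Suc j * q ^ (Suc j choose 2))) n)" .
  show ?thesis
    using L unfolding q_binomial_theorem R mult_left_cancel[OF K] .
qed

text \<open>For \<open>a = 1\<close> and \<open>b = q\<close> the product \<open>qpoch a q n\<close>
  contains the factor \<open>1 - 1\<close> as soon as \<open>n\<close> is positive.\<close>

lemma unit_bailey_pair:
  assumes "q \<noteq> 0"
  shows "bailey (\<lambda>j. (-1) ^ j * (q ^ (j choose 2) - q ^ Suc j * q ^ (Suc j choose 2))) n =
    (if n = 0 then 1 else 0)"
proof -
  have "qpoch 1 q n = (if n = 0 then 1 else 0)"
    by (cases n) (simp_all add: qpoch_Suc_shift)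
  moreover have "qpoch q q (Suc 0) \<noteq> 0" by (rule Q_nonzero)
  ultimately show ?thesis
    using finite_jacobi_triple_product[of 1 q n] assms Q_nonzero[of "2 * n + 1"]
    by (cases "n = 0") auto
qed

text \<open>The limit of the finite form. The \<open>j\<close>-th summand merges the terms of index
  \<open>j\<close> and \<open>- j - 1\<close> of the bilateral theta series, rewritten with
  \<open>a * b = q\<close>.\<close>

theorem jacobi_triple_product:
  assumes ab: "a * b = q" and nz: "q \<noteq> 0" and "norm a < 1" "norm b < 1"
  shows "(\<Sum>j. (-1) ^ j * (a ^ j * q ^ (j choose 2) - b ^ Suc j * q ^ (Suc j choose 2))) =
    qpoch_inf a q * qpoch_inf b q * Qinf"
proof -
  let ?\<alpha> = "\<lambda>j. (-1) ^ j * (a ^ j * q ^ (j choose 2) - b ^ Suc j * q ^ (Suc j choose 2))"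
  have bound: "norm (?\<alpha> j) \<le> norm a ^ j + norm b ^ Suc j" for j
  proof -
    have *: "norm (c * q ^ i) \<le> norm c" for c i
      unfolding norm_mult using norm_power_le[of 0 i] by (intro mult_right_le_one_le) auto
    have "norm (?\<alpha> j) = norm (a ^ j * q ^ (j choose 2) - b ^ Suc j * q ^ (Suc j choose 2))"
      unfolding norm_mult[of "(-1) ^ j"] by (simp add: norm_power)
    also have "\<dots> \<le> norm (a ^ j * q ^ (j choose 2)) + norm (b ^ Suc j * q ^ (Suc j choose 2))"
      by (rule norm_triangle_ineq4)
    also have "\<dots> \<le> norm (a ^ j) + norm (b ^ Suc j)"
      by (intro add_mono *)
    finally show ?thesis by (simp only: norm_power)
  qed
  have "summable (\<lambda>j. norm a ^ j + norm b ^ Suc j)"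
    using assms by (intro summable_add summable_geometric summable_Suc_iff[THEN iffD2]) auto
  note B = LIMSEQ_bailey(1)[of ?\<alpha>, OF bound this]
  have "(\<lambda>n. Q (2 * n + 1) * bailey ?\<alpha> n) \<longlonglongrightarrow> Qinf * (suminf ?\<alpha> / (Qinf * Qinf))"
  proof (intro tendsto_intros B tendsto_Q)
    show "filterlim (\<lambda>n. 2 * n + 1 :: nat) at_top sequentially"
      by (rule filterlim_subseq) (simp add: strict_mono_def)
  qed
  moreover have "(\<lambda>n. qpoch a q n * qpoch b q (Suc n)) \<longlonglongrightarrow> qpoch_inf a q * qpoch_inf b q"
    by (intro tendsto_intros qpoch_LIMSEQ[OF q] LIMSEQ_Suc)
  ultimately have "Qinf * (suminf ?\<alpha> / (Qinf * Qinf)) = qpoch_inf a q * qpoch_inf b q"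
    unfolding finite_jacobi_triple_product[OF ab nz] by (rule LIMSEQ_unique)
  then show ?thesis by (simp add: divide_simps)
qed

section \<open>The modulus 7 identity\<close>

text \<open>The inner sum of the Andrews-Gordon series. Up to the factor \<open>1 / Q n\<close> it
  is the q-binomial sum of \<open>shifted_durfee_sums\<close> at \<open>c = 1\<close>.\<close>

definition gordon_poly :: "nat \<Rightarrow> complex" where
  "gordon_poly n = (\<Sum>r\<le>n. q ^ (r * (r + 1)) / (Q (n - r) * Q r))"

text \<open>Successive Bailey steps turn the unit pair into \<open>1 / Q n\<close>, then
  \<open>gordon_poly n\<close>, then a convolution whose limit is the series divided by
  \<open>Qinf\<close>.\<close>

lemma gordon_sums:
  assumes "q \<noteq> 0"
  shows "(\<lambda>n. q ^ (n * (n + 1)) * gordon_poly n) sums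
     ((\<Sum>j. (-1) ^ j * ((q ^ 6) ^ j * (q ^ 7) ^ (j choose 2) - q ^ Suc j * (q ^ 7) ^ (Suc j choose 2))) / Qinf)"
    (is "_ sums (suminf ?\<delta> / _)")
proof -
  let ?\<alpha> = "\<lambda>j. (-1) ^ j * (q ^ (j choose 2) - q ^ Suc j * q ^ (Suc j choose 2))"
  let ?w = "\<lambda>j. q ^ (j * (j + 1))"
  have b1: "bailey (\<lambda>j. ?w j * ?\<alpha> j) n = 1 / Q n" for n
    unfolding bailey_step[of n "?\<alpha>", symmetric] unit_bailey_pair[OF assms]
    by (subst sum.mono_neutral_right[of _ "{0}"]) auto
  have b2: "bailey (\<lambda>j. ?w j * (?w j * ?\<alpha> j)) n = gordon_poly n" for n
    unfolding bailey_step[of n "\<lambda>j. ?w j * ?\<alpha> j", symmetric] b1 gordon_poly_def by simp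
  have b3: "bailey (\<lambda>j. ?w j * (?w j * (?w j * ?\<alpha> j))) n = (\<Sum>r\<le>n. ?w r / Q (n - r) * gordon_poly r)" for n
    unfolding bailey_step[of n "\<lambda>j. ?w j * (?w j * ?\<alpha> j)", symmetric] b2 by simp
  have \<delta>: "(\<lambda>j. ?w j * (?w j * (?w j * ?\<alpha> j))) = ?\<delta>"
  proof
    fix j
    \<comment> \<open>Three factors \<open>?w j\<close> contribute the exponent
      \<open>3 * j * (j + 1)\<close>. Added to \<open>j choose 2\<close> this gives
      \<open>6 * j + 7 * (j choose 2)\<close>; added to \<open>Suc j choose 2\<close> it gives
      \<open>7 * (Suc j choose 2)\<close>. This is where 7 arises.\<close>
    have c: "j * (j + 1) = 2 * (j choose 2) + 2 * j" "j * (j + 1) = 2 * (Suc j choose 2)"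
      by (induction j) (simp_all add: numeral_2_eq_2 binomial_eq_0)
    have "?w j * (?w j * (?w j * q ^ (j choose 2))) = (q ^ 6) ^ j * (q ^ 7) ^ (j choose 2)"
      unfolding power_add[symmetric] power_mult[symmetric] using c(1) by (intro arg_cong[of _ _ "(^) q"]) simp
    moreover have "?w j * (?w j * (?w j * (q ^ Suc j * q ^ (Suc j choose 2)))) = q ^ Suc j * (q ^ 7) ^ (Suc j choose 2)"
      unfolding power_add[symmetric] power_mult[symmetric] using c(2) by (intro arg_cong[of _ _ "(^) q"]) simp
    ultimately show "?w j * (?w j * (?w j * ?\<alpha> j)) = ?\<delta> j"
      by (simp only: right_diff_distrib mult.left_commute[of _ "(-1) ^ j"])
  qed
  have w: "norm (?w j * z) \<le> norm q ^ j * norm z" for j z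
    unfolding norm_mult by (intro mult_right_mono norm_power_le) auto
  have w1: "norm (?w j * z) \<le> norm z" for j z
    unfolding norm_mult using norm_power_le[of 0 "j * (j + 1)"] by (intro mult_left_le_one_le) auto
  have "norm (?\<alpha> j) \<le> 2" for j
  proof -
    have "norm (?\<alpha> j) = norm (q ^ (j choose 2) - q ^ (Suc j + (Suc j choose 2)))"
      unfolding norm_mult[of "(-1) ^ j"] by (simp add: norm_power power_add mult.assoc)
    also have "\<dots> \<le> norm (q ^ (j choose 2)) + norm (q ^ (Suc j + (Suc j choose 2)))"
      by (rule norm_triangle_ineq4)
    also have "\<dots> \<le> 1 + 1"
      using norm_power_le[of 0 "_ :: nat"] by (intro add_mono) (simp_all only: power_0)
    finally show ?thesis by simp
  qed
  then have "norm q ^ j * norm (?\<alpha> j) \<le> 2 * norm q ^ j" for j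
    by (subst mult.commute, intro mult_right_mono) auto
  then have bound: "norm (?w j * ?\<alpha> j) \<le> 2 * norm q ^ j" for j
    using w order_trans by blast
  then have bound2: "norm (?w j * (?w j * ?\<alpha> j)) \<le> 2 * norm q ^ j" for j
    using w1 order_trans by blast
  then have bound3: "norm (?w j * (?w j * (?w j * ?\<alpha> j))) \<le> 2 * norm q ^ j" for j
    using w1 order_trans by blast
  have "Bseq gordon_poly"
    using LIMSEQ_bailey(2)[of "\<lambda>j. ?w j * (?w j * ?\<alpha> j)", OF bound2 summable_norm_q]
    unfolding b2 .
  then obtain G where G: "\<And>n. norm (gordon_poly n) \<le> G"
    unfolding Bseq_def by blast
  obtain C where C: "\<And>n. norm (Q n) \<le> C" "\<And>n. norm (1 / Q n) \<le> C" "C \<ge> 0"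
    using Q_bounds by blast
  let ?a = "\<lambda>r n. ?w r / Q (n - r) * gordon_poly r"
  let ?b = "\<lambda>r. ?w r / Qinf * gordon_poly r"
  have lim: "(\<lambda>n. ?a r n) \<longlonglongrightarrow> ?b r" for r
    by (intro tendsto_intros tendsto_Q filterlim_minus_const_nat_at_top) auto
  have bnd: "norm (?a r n) \<le> (C * G) * norm q ^ r" for r n
  proof -
    have "?a r n = (1 / Q (n - r) * gordon_poly r) * ?w r" by simp
    also have "norm \<dots> \<le> (C * G) * norm q ^ r"
      unfolding norm_mult[of _ "_ :: complex"] using C G order_trans[OF norm_ge_zero G]
      by (intro mult_mono mult_nonneg_nonneg norm_ge_zero norm_power_le) auto
    finally show ?thesis .
  qed
  note T = tendsto_sum_dominated[of ?a ?b, OF lim bnd summable_norm_q]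
  \<comment> \<open>The third transform has two limits: termwise in the convolution, and through
    \<open>LIMSEQ_bailey\<close>.\<close>
  have "suminf ?b = suminf ?\<delta> / (Qinf * Qinf)"
    using T(1) LIMSEQ_bailey(1)[OF bound3 summable_norm_q]
    unfolding b3[symmetric] \<delta> by (rule LIMSEQ_unique)
  with T(2) have "?b sums (suminf ?\<delta> / (Qinf * Qinf))"
    using summable_sums[of ?b] summable_norm_cancel by metis
  from sums_mult[OF this, of Qinf] show ?thesis by simp
qed

text \<open>Comparison with a product of two geometric series gives absolute convergence, which
  justifies summing over \<open>n\<close> first.\<close>

lemma summable_gordon_product:
  "(\<lambda>(l, n). q ^ (l * (l + 1)) / Q l * (q ^ (n * (n + 1)) / (Q n * Q (n + 1 + l)))) summable_on UNIV"
proof -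
  obtain C where C: "\<And>n. norm (Q n) \<le> C" "\<And>n. norm (1 / Q n) \<le> C" "C \<ge> 0"
    using Q_bounds by blast
  have g: "(\<lambda>n. norm q ^ n) summable_on UNIV"
    using q by (intro summable_nonneg_imp_summable_on summable_geometric) auto
  have "(\<lambda>(l, n). (C * C * C) * norm q ^ l * norm q ^ n) summable_on (UNIV \<times> UNIV)"
  proof (rule summable_on_SigmaI)
    show "((\<lambda>n. case (l, n) of (l, n) \<Rightarrow> (C * C * C) * norm q ^ l * norm q ^ n) has_sum
        ((C * C * C) * norm q ^ l * (\<Sum>\<^sub>\<infinity>n. norm q ^ n))) UNIV" for l
      unfolding case_prod_conv by (intro has_sum_cmult_right has_sum_infsum g)
    show "(\<lambda>l. (C * C * C) * norm q ^ l * (\<Sum>\<^sub>\<infinity>n. norm q ^ n)) summable_on UNIV"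
      by (intro summable_on_cmult_left summable_on_cmult_right g)
  qed (use C in auto)
  then have "(\<lambda>(l, n). (C * C * C) * norm q ^ l * norm q ^ n) summable_on UNIV"
    by simp
  note dominated = Infinite_Sum.abs_summable_on_comparison_test'[OF this]
  show ?thesis
  proof (rule abs_summable_summable, rule dominated)
    fix x :: "nat \<times> nat"
    obtain l n where x: "x = (l, n)" by force
    have "q ^ (l * (l + 1)) / Q l * (q ^ (n * (n + 1)) / (Q n * Q (n + 1 + l))) =
        ((1 / Q l) * (1 / Q n) * (1 / Q (n + 1 + l))) * q ^ (l * (l + 1)) * q ^ (n * (n + 1))"
      by simp
    also have "norm \<dots> \<le> (C * C * C) * norm q ^ l * norm q ^ n"
      unfolding norm_mult[of _ "_ :: complex"] using C
      by (intro mult_mono mult_nonneg_nonneg norm_ge_zero norm_power_le) auto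
    finally show "norm (case x of (l, n) \<Rightarrow> q ^ (l * (l + 1)) / Q l * (q ^ (n * (n + 1)) / (Q n * Q (n + 1 + l))))
      \<le> (case x of (l, n) \<Rightarrow> (C * C * C) * norm q ^ l * norm q ^ n)"
      by (simp only: x case_prod_conv)
  qed
qed

text \<open>For fixed \<open>l\<close> the inner series is \<open>shifted_durfee_sums\<close> at
  \<open>c = 1\<close>; the factor \<open>1 / Q l\<close> cancels the numerator of the q-binomials
  and leaves \<open>gordon_poly l\<close>.\<close>

lemma has_sum_gordon_product:
  assumes S: "(\<lambda>n. q ^ (n * (n + 1)) * gordon_poly n) sums S"
  shows "((\<lambda>(l, n). q ^ (l * (l + 1)) / Q l * (q ^ (n * (n + 1)) / (Q n * Q (n + 1 + l))))
    has_sum (S / Qinf)) UNIV" (is "(?f has_sum _) UNIV")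
proof -
  have inner: "((\<lambda>n. ?f (l, n)) has_sum (q ^ (l * (l + 1)) * gordon_poly l / Qinf)) UNIV" for l
  proof -
    have "q ^ (l * (l + 1)) / Q l * ((\<Sum>j\<le>l. qbinom q l j * q ^ (j * (j + 1))) / Qinf) =
        q ^ (l * (l + 1)) * gordon_poly l / Qinf"
      unfolding gordon_poly_def sum_divide_distrib sum_distrib_left
      by (intro sum.cong) (auto simp: qbinom_def)
    then have sums: "(\<lambda>n. ?f (l, n)) sums (q ^ (l * (l + 1)) * gordon_poly l / Qinf)"
      using sums_mult[OF shifted_durfee_sums[of 1 l], of "q ^ (l * (l + 1)) / Q l"] by simp
    have "(\<lambda>n. ?f (l, n)) summable_on UNIV"
      using summable_on_SigmaD1[of "\<lambda>l n. ?f (l, n)" UNIV "\<lambda>_. UNIV" l] summable_gordon_product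
      by simp
    then have total: "((\<lambda>n. ?f (l, n)) has_sum (\<Sum>\<^sub>\<infinity>n. ?f (l, n))) UNIV"
      by (rule has_sum_infsum)
    from sums have "(\<Sum>\<^sub>\<infinity>n. ?f (l, n)) = q ^ (l * (l + 1)) * gordon_poly l / Qinf"
      by (rule sums_unique2[OF has_sum_imp_sums[OF total]])
    with total show ?thesis by (simp only:)
  qed
  have total: "(?f has_sum infsum ?f UNIV) (UNIV \<times> UNIV)"
    using summable_gordon_product by simp
  have "((\<lambda>l. q ^ (l * (l + 1)) * gordon_poly l / Qinf) has_sum infsum ?f UNIV) UNIV"
    using has_sum_Sigma'[OF total inner] .
  then have "(\<lambda>l. q ^ (l * (l + 1)) * gordon_poly l / Qinf) sums infsum ?f UNIV"
    by (rule has_sum_imp_sums)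
  moreover have "(\<lambda>l. q ^ (l * (l + 1)) * gordon_poly l / Qinf) sums (S / Qinf)"
    by (rule sums_divide[OF S])
  ultimately have "infsum ?f UNIV = S / Qinf"
    by (rule sums_unique2)
  then show ?thesis
    using total by simp
qed

text \<open>Sort the factors of \<open>Q (7 * N)\<close> by residue modulo 7: the classes 1, 6 and 0
  form the three products in base \<open>q ^ 7\<close>, and the other classes form the reciprocal of
  the left-hand side.\<close>

lemma gordon_prodinf:
  "(\<Prod>m. if m \<ge> 1 \<and> m mod 7 \<notin> {0, 1, 6} then 1 / (1 - q ^ m) else 1) =
     qpoch_inf (q ^ 6) (q ^ 7) * qpoch_inf q (q ^ 7) * qpoch_inf (q ^ 7) (q ^ 7) / Qinf"
proof -
  define h where "h m = (if m \<ge> 1 \<and> m mod 7 \<notin> {0, 1, 6} then 1 - q ^ m else 1)" for m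
  have nz: "1 - q ^ m \<noteq> 0" if "m \<ge> 1" for m
    using that Q_nonzero[of m] by (cases m) (simp_all add: Q_Suc)
  have q7: "norm (q ^ 7) < 1"
    using norm_power_le[of 1 7] q by simp
  have "summable (\<lambda>m. norm (h m - 1))"
    by (rule summable_comparison_test'[OF summable_norm_q[of 1], of 0]) (auto simp: h_def norm_power)
  then have conv: "convergent_prod h"
    by (intro abs_convergent_prod_imp_convergent_prod summable_imp_abs_convergent_prod)
  \<comment> \<open>The range has \<open>7 * N + 1\<close> elements because it includes
    \<open>m = 0\<close>, where \<open>h\<close> is 1.\<close>
  have fin: "(\<Prod>m<7 * N + 1. h m) * (qpoch (q ^ 6) (q ^ 7) N * qpoch q (q ^ 7) N * qpoch (q ^ 7) (q ^ 7) N) = Q (7 * N)" for N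
  proof (induction N)
    case 0
    show ?case by (simp add: h_def)
  next
    case (Suc N)
    let ?z = "(q ^ 7) ^ N"
    \<comment> \<open>A block starts at residue 1, so \<open>i\<close> in 1 to 4 covers the residues
      2 to 5.\<close>
    have h: "h (7 * N + 1 + i) = (if i \<in> {1, 2, 3, 4} then 1 - q ^ Suc i * ?z else 1)" if "i < 7" for i
    proof -
      have "(7 * N + 1 + i) mod 7 \<notin> {0, 1, 6} \<longleftrightarrow> i \<in> {1, 2, 3, 4}"
        using that by (subgoal_tac "i \<in> {0, 1, 2, 3, 4, 5, 6}") (auto simp: mod_Suc)
      moreover have "q ^ (7 * N) = ?z" by (rule power_mult)
      ultimately show ?thesis
        by (simp add: h_def power_add mult_ac)
    qed
    have s: "{..<7::nat} = {0, 1, 2, 3, 4, 5, 6}" by auto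
    have "(\<Prod>m<7 * Suc N + 1. h m) = (\<Prod>m<7 * N + 1. h m) * (\<Prod>i<7. h (7 * N + 1 + i))"
      using prod_lessThan_add[of h "7 * N + 1" 7] by (simp add: algebra_simps)
    also have "(\<Prod>i<7. h (7 * N + 1 + i)) = (\<Prod>i<7. if i \<in> {1, 2, 3, 4} then 1 - q ^ Suc i * ?z else 1)"
      by (intro prod.cong refl h) simp
    also have "\<dots> = (1 - q ^ 2 * ?z) * (1 - q ^ 3 * ?z) * (1 - q ^ 4 * ?z) * (1 - q ^ 5 * ?z)"
      unfolding s by (simp add: numeral_eq_Suc)
    finally have P: "(\<Prod>m<7 * Suc N + 1. h m) = (\<Prod>m<7 * N + 1. h m) *
        ((1 - q ^ 2 * ?z) * (1 - q ^ 3 * ?z) * (1 - q ^ 4 * ?z) * (1 - q ^ 5 * ?z))" .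
    have "Q (7 * Suc N) = Q (7 * N) * (\<Prod>i<7. 1 - q * q ^ (7 * N + i))"
      unfolding qpoch_def using prod_lessThan_add[of "\<lambda>i. 1 - q * q ^ i" "7 * N" 7]
      by (simp add: algebra_simps)
    also have "(\<Prod>i<7. 1 - q * q ^ (7 * N + i)) = (\<Prod>i<7. 1 - q ^ Suc i * ?z)"
      unfolding power_add power_mult by (simp add: mult_ac)
    also have "\<dots> = (1 - q * ?z) * (1 - q ^ 2 * ?z) * (1 - q ^ 3 * ?z) * (1 - q ^ 4 * ?z) *
        (1 - q ^ 5 * ?z) * (1 - q ^ 6 * ?z) * (1 - q ^ 7 * ?z)"
      unfolding s by (simp add: numeral_eq_Suc mult_ac)
    finally show ?case
      unfolding P Suc.IH[symmetric] qpoch_Suc by (simp only: mult_ac)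
  qed
  have lim7: "filterlim (\<lambda>N. 7 * N :: nat) at_top sequentially" "filterlim (\<lambda>N. 7 * N + 1 :: nat) at_top sequentially"
    by (rule filterlim_subseq, simp add: strict_mono_def)+
  have "(\<lambda>N. (\<Prod>m<7 * N + 1. h m) * (qpoch (q ^ 6) (q ^ 7) N * qpoch q (q ^ 7) N * qpoch (q ^ 7) (q ^ 7) N))
      \<longlonglongrightarrow> prodinf h * (qpoch_inf (q ^ 6) (q ^ 7) * qpoch_inf q (q ^ 7) * qpoch_inf (q ^ 7) (q ^ 7))"
    by (intro tendsto_intros qpoch_LIMSEQ q7
        filterlim_compose[OF convergent_prod_LIMSEQ_lessThan[OF conv] lim7(2)])
  moreover have "(\<lambda>N. Q (7 * N)) \<longlonglongrightarrow> Qinf"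
    by (rule tendsto_Q[OF lim7(1)])
  ultimately have "prodinf h * (qpoch_inf (q ^ 6) (q ^ 7) * qpoch_inf q (q ^ 7) * qpoch_inf (q ^ 7) (q ^ 7)) = Qinf"
    unfolding fin by (rule LIMSEQ_unique)
  moreover have "prodinf h \<noteq> 0"
    by (rule prodinf_nonzero[OF conv]) (use nz in \<open>auto simp: h_def\<close>)
  moreover have "(\<Prod>m. if m \<ge> 1 \<and> m mod 7 \<notin> {0, 1, 6} then 1 / (1 - q ^ m) else 1) = inverse (prodinf h)"
    unfolding prodinf_inverse[OF conv, symmetric]
    by (intro prodinf_cong) (auto simp: h_def divide_inverse)
  ultimately show ?thesis
    by (simp only:) (simp add: field_simps)
qed

end

theorem mainTheorem10:
  fixes q :: complex
  assumes "norm q < 1"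
  shows "((\<lambda>(n, l). q ^ (n^2 + l^2 + n + l) /
             (qpoch (q^2) q (n + l) * qpoch q q n * qpoch q q l)) has_sum
           (1 / qpoch_inf (q^2) q *
             (\<Prod>m. if m \<ge> 1 \<and> m mod 7 \<notin> {0, 1, 6} then 1 / (1 - q ^ m) else 1)))
         (UNIV :: (nat \<times> nat) set)"
proof (cases "q = 0")
  \<comment> \<open>The finite triple product cancels powers of \<open>q\<close>, so
    \<open>q = 0\<close> is separate; only the term \<open>(0, 0)\<close> survives.\<close>
  case True
  have "((\<lambda>(n, l). q ^ (n^2 + l^2 + n + l) /
             (qpoch (q^2) q (n + l) * qpoch q q n * qpoch q q l)) has_sum 1) (UNIV :: (nat \<times> nat) set)"
    by (rule has_sum_finite_neutralI[of "{(0, 0)}"]) (auto simp: True)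
  moreover have "(\<lambda>m. if m \<ge> 1 \<and> m mod 7 \<notin> {0, 1, 6} then 1 / (1 - q ^ m) else 1) = (\<lambda>m. 1)"
    by (rule ext) (simp add: True power_0_left)
  ultimately show ?thesis
    by (simp add: True qpoch_inf_def)
next
  case False
  let ?Qinf = "qpoch_inf q q"
  let ?P = "\<Prod>m. if m \<ge> 1 \<and> m mod 7 \<notin> {0, 1, 6} then 1 / (1 - q ^ m) else 1"
  have "norm (q ^ k) < 1" if "k \<ge> 1" for k
    using norm_power_le[OF assms that] assms by simp
  moreover have q6: "q ^ 6 * q = q ^ 7"
    using power_add[of q 6 1] by simp
  ultimately have "suminf (\<lambda>j. (-1) ^ j * ((q ^ 6) ^ j * (q ^ 7) ^ (j choose 2) - q ^ Suc j * (q ^ 7) ^ (Suc j choose 2)))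
      = qpoch_inf (q ^ 6) (q ^ 7) * qpoch_inf q (q ^ 7) * qpoch_inf (q ^ 7) (q ^ 7)"
    using False assms by (intro jacobi_triple_product q6) auto
  then have "(\<lambda>n. q ^ (n * (n + 1)) * gordon_poly q n) sums ?P"
    using gordon_sums[OF assms False] gordon_prodinf[OF assms] by simp
  from has_sum_gordon_product[OF assms this]
  have "((\<lambda>x. (1 - q) * (case x of (l, n) \<Rightarrow> q ^ (l * (l + 1)) / qpoch q q l *
      (q ^ (n * (n + 1)) / (qpoch q q n * qpoch q q (n + 1 + l))))) has_sum (1 - q) * (?P / ?Qinf)) UNIV"
    by (rule has_sum_cmult_right)
  moreover have "(1 - q) * (?P / ?Qinf) = 1 / qpoch_inf (q\<^sup>2) q * ?P"
    using one_minus_nonzero[OF assms] qpoch_inf_shift[OF assms assms] by (simp add: power2_eq_square)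
  \<comment> \<open>The first component is \<open>l\<close> on the left and \<open>n\<close> on the
    right, so only names change. The factor \<open>1 - q\<close> turns
    \<open>qpoch q q (n + 1 + l)\<close> into \<open>qpoch (q^2) q (n + l)\<close>.\<close>
  moreover have "(\<lambda>x. (1 - q) * (case x of (l, n) \<Rightarrow> q ^ (l * (l + 1)) / qpoch q q l *
      (q ^ (n * (n + 1)) / (qpoch q q n * qpoch q q (n + 1 + l))))) =
    (\<lambda>(n, l). q ^ (n^2 + l^2 + n + l) / (qpoch (q^2) q (n + l) * qpoch q q n * qpoch q q l))"
  proof (rule ext, clarify)
    fix l n :: nat
    have "qpoch q q (n + 1 + l) = (1 - q) * qpoch (q\<^sup>2) q (l + n)"
      using qpoch_Suc_shift[of q q "l + n"] by (simp add: power2_eq_square add.commute)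
    moreover have "q ^ (l\<^sup>2 + n\<^sup>2 + l + n) = q ^ (l * (l + 1)) * q ^ (n * (n + 1))"
      by (simp add: power_add[symmetric] power2_eq_square algebra_simps)
    ultimately show "(1 - q) * (q ^ (l * (l + 1)) / qpoch q q l *
      (q ^ (n * (n + 1)) / (qpoch q q n * qpoch q q (n + 1 + l)))) =
      q ^ (l\<^sup>2 + n\<^sup>2 + l + n) / (qpoch (q\<^sup>2) q (l + n) * qpoch q q l * qpoch q q n)"
      using one_minus_nonzero[OF assms] by simp
  qed
  ultimately show ?thesis by (simp only:)
qed

end
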